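(* Let $A=W\Sigma V^*\in\mathbb{C}^{n\times n}$ with $\Sigma=\mathrm{diag}(\sigma_1,\dots,\sigma_n)$, $\sigma_j>0$ for $j=1,\dots,n$, and unitary matrices $W,V\in\mathbb{C}^{n\times n}$. Consider the iteration $$X_0=A,\qquad X_{k+1}=\tfrac12\,(X_k+X_k^{-*}),\quad k=0,1,2,\dots.$$ Then the iteration is meaningful and its sequence of iterates $\{X_k\}$ converges to the unitary polar factor $U=WV^*$ of $A$. Moreover, with $t_0\equiv\frac12\max_{1\le j\le n}|\sigma_j-\sigma_j^{-1}|$ and the functions $$\omega(t)=\frac{t^2}{2(t^2+1)^{1/2}},\qquad \sigma(t)=t-1+(t^2+1)^{1/2},$$ we have $$\|U-X_k\|\le \sigma(\omega^{(k)}(t_0)),\qquad k=0,1,2,\dots,$$ and this inequality is an equality for all $k\ge 1$.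
   Context: $\|\cdot\|$ denotes the spectral norm (operator 2-norm) on $\mathbb{C}^{n\times n}$. $X^*$ is the conjugate transpose and $X^{-*}=(X^{-1})^*$. The iteration is called meaningful if all iterates are well defined and lie in the domain of the iteration map, i.e., every $X_k$, $k\ge0$, is invertible. $\omega^{(k)}$ denotes the $k$-th iterate of the function $\omega$: $\omega^{(0)}(t)=t$ and $\omega^{(k)}(t)=\omega(\omega^{(k-1)}(t))$ for $k\ge1$. The formulas for $\omega$ and $\sigma$ are used for all $t\ge 0$. The function $\sigma$ should not be confused with the singular values $\sigma_j$. The unitary polar factor of $A=W\Sigma V^*$ is the unitary matrix $U=WV^*$ in the polar decomposition $A=UH$, where $H=V\Sigma V^*$ is Hermitian positive definite. *)

theory Defs
  imports "HOL-Analysis.Analysis"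
begin

definition adjoint_matrix :: "complex^'n^'m \<Rightarrow> complex^'m^'n" where
  "adjoint_matrix A = (\<chi> i j. cnj (A $ j $ i))"

definition unitary_matrix :: "complex^'n^'n \<Rightarrow> bool" where
  "unitary_matrix U \<longleftrightarrow> adjoint_matrix U ** U = mat 1 \<and> U ** adjoint_matrix U = mat 1"

(* For a Hermitian matrix the quadratic form below is real-valued, so Re loses nothing. *)
definition hermitian_pos_def :: "complex^'n^'n \<Rightarrow> bool" where
  "hermitian_pos_def H \<longleftrightarrow> adjoint_matrix H = H \<and>
     (\<forall>x. x \<noteq> 0 \<longrightarrow> Re (\<Sum>i\<in>UNIV. cnj (x $ i) * (H *v x) $ i) > 0)"

definition polar_decomposition ::
  "complex^'n^'n \<Rightarrow> complex^'n^'n \<Rightarrow> complex^'n^'n \<Rightarrow> bool" where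
  "polar_decomposition A U H \<longleftrightarrow> unitary_matrix U \<and> hermitian_pos_def H \<and> A = U ** H"

definition real_diag :: "('n \<Rightarrow> real) \<Rightarrow> complex^'n^'n" where
  "real_diag s = (\<chi> i j. if i = j then complex_of_real (s i) else 0)"

(* The library norm on complex^'n is the Euclidean norm, so this is the operator 2-norm;
   the library norm on complex^'n^'n is instead the Frobenius norm. *)
definition spectral_norm :: "complex^'n^'n \<Rightarrow> real" where
  "spectral_norm A = onorm (\<lambda>x. A *v x)"

(* matrix_inv is total with an unspecified value on singular matrices: the iterates are
   meaningful only as long as each of them is invertible. *)
primrec newton_iterate :: "complex^'n^'n \<Rightarrow> nat \<Rightarrow> complex^'n^'n" where
  "newton_iterate A 0 = A"
| "newton_iterate A (Suc k) =
     (1/2) *\<^sub>R (newton_iterate A k + adjoint_matrix (matrix_inv (newton_iterate A k)))"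

definition omega_fun :: "real \<Rightarrow> real" where
  "omega_fun t = t\<^sup>2 / (2 * sqrt (t\<^sup>2 + 1))"

definition sigma_fun :: "real \<Rightarrow> real" where
  "sigma_fun t = t - 1 + sqrt (t\<^sup>2 + 1)"

end

theory Submission
  imports Defs
begin

text \<open>
  In the singular vector bases the iteration decouples: the adjoint inverse of
  \<open>W ** real_diag r ** adjoint_matrix V\<close> is the same product with \<open>r\<close> inverted entrywise, so the
  \<open>k\<close>-th iterate has the singular values obtained from \<open>s j\<close> by \<open>k\<close> steps of the scalar map
  \<open>newton_scalar\<close>, that is \<open>x \<mapsto> (x + 1/x) / 2\<close> (lemma \<open>newton_iterate_diagonal\<close>).

  With \<open>x > 0\<close> associate its deviation \<open>t = \<bar>x - 1/x\<bar> / 2\<close>. One step maps \<open>x\<close> to \<open>sqrt (t\<^sup>2 + 1) \<ge> 1\<close>,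
  whose deviation is \<open>omega_fun t\<close>. Moreover the larger of \<open>x\<close> and \<open>1/x\<close> is \<open>t + sqrt (t\<^sup>2 + 1)\<close>,
  which gives \<open>\<bar>1 - x\<bar> \<le> sigma_fun t\<close>, with equality if \<open>x \<ge> 1\<close>. After the first step
  all scalars are at least 1, whence equality for \<open>k \<ge> 1\<close>.

  As unitary matrices preserve the Euclidean norm, the spectral norm of the error is the largest
  of the scalar errors. Since \<open>omega_fun\<close> and \<open>sigma_fun\<close> are increasing on nonnegative numbers,
  all scalar errors are bounded by the expression formed with the largest initial deviation \<open>t0\<close>,
  and for \<open>k \<ge> 1\<close> the index where \<open>t0\<close> is attained meets this bound. Finally
  \<open>omega_fun t \<le> t / 2\<close> makes the deviations, and hence the errors, tend to 0.
\<close>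

section \<open>Adjoints and unitary matrices\<close>

lemma adjoint_matrix_adjoint [simp]: "adjoint_matrix (adjoint_matrix A) = A"
  by (simp add: adjoint_matrix_def vec_eq_iff)

lemma adjoint_matrix_mult: "adjoint_matrix (A ** B) = adjoint_matrix B ** adjoint_matrix A"
  by (simp add: adjoint_matrix_def matrix_matrix_mult_def vec_eq_iff mult.commute)

lemma adjoint_real_diag [simp]: "adjoint_matrix (real_diag r) = real_diag r"
  by (auto simp: adjoint_matrix_def real_diag_def vec_eq_iff)

lemma adjoint_matrix_inner:
  "(\<Sum>i\<in>UNIV. cnj (x $ i) * (A *v y) $ i) = (\<Sum>i\<in>UNIV. cnj ((adjoint_matrix A *v x) $ i) * y $ i)"
proof -
  have "(\<Sum>i\<in>UNIV. cnj (x $ i) * (A *v y) $ i)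
      = (\<Sum>i\<in>UNIV. \<Sum>j\<in>UNIV. cnj (x $ i) * (A $ i $ j * y $ j))"
    by (simp add: matrix_vector_mult_def sum_distrib_left)
  also have "\<dots> = (\<Sum>j\<in>UNIV. \<Sum>i\<in>UNIV. cnj (x $ i) * (A $ i $ j * y $ j))"
    by (rule sum.swap)
  also have "\<dots> = (\<Sum>j\<in>UNIV. cnj ((adjoint_matrix A *v x) $ j) * y $ j)"
    by (simp add: matrix_vector_mult_def adjoint_matrix_def sum_distrib_right
        sum_distrib_left mult_ac)
  finally show ?thesis .
qed

lemma power2_norm_complex_vec:
  fixes x :: "complex^'n"
  shows "complex_of_real ((norm x)\<^sup>2) = (\<Sum>i\<in>UNIV. cnj (x $ i) * x $ i)"
proof -
  have "(norm x)\<^sup>2 = (\<Sum>i\<in>UNIV. (norm (x $ i))\<^sup>2)"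
    by (simp add: norm_vec_def L2_set_def sum_nonneg)
  then show ?thesis
    by (simp add: complex_norm_square mult.commute del: of_real_power)
qed

lemma unitary_matrix_adjoint: "unitary_matrix U \<Longrightarrow> unitary_matrix (adjoint_matrix U)"
  by (simp add: unitary_matrix_def)

lemma unitary_matrix_mult:
  assumes "unitary_matrix U" "unitary_matrix V"
  shows "unitary_matrix (U ** V)"
proof -
  have "adjoint_matrix V ** adjoint_matrix U ** (U ** V)
      = adjoint_matrix V ** (adjoint_matrix U ** U) ** V"
    "U ** V ** (adjoint_matrix V ** adjoint_matrix U)
      = U ** (V ** adjoint_matrix V) ** adjoint_matrix U"
    by (simp_all only: matrix_mul_assoc)
  with assms show ?thesis
    by (simp add: unitary_matrix_def adjoint_matrix_mult)
qed

lemma norm_unitary_matrix_mult: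
  fixes U :: "complex^'n^'n"
  assumes "unitary_matrix U"
  shows "norm (U *v x) = norm x"
proof -
  have "complex_of_real ((norm (U *v x))\<^sup>2) = complex_of_real ((norm x)\<^sup>2)"
    using assms
    by (simp only: power2_norm_complex_vec adjoint_matrix_inner matrix_vector_mul_assoc
        unitary_matrix_def matrix_vector_mul_lid)
  then have "(norm (U *v x))\<^sup>2 = (norm x)\<^sup>2"
    by (simp only: of_real_eq_iff)
  then show ?thesis by simp
qed

section \<open>Matrices diagonalised by two unitary matrices\<close>

lemma real_diag_mult_vector_nth: "(real_diag r *v x) $ i = complex_of_real (r i) * x $ i"
proof -
  have "(real_diag r *v x) $ i = (\<Sum>j\<in>UNIV. if j = i then complex_of_real (r i) * x $ i else 0)"
    unfolding real_diag_def matrix_vector_mult_def vec_lambda_beta by (rule sum.cong) auto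
  then show ?thesis by simp
qed

lemma real_diag_mult: "real_diag r ** real_diag q = real_diag (\<lambda>j. r j * q j)"
  by (simp add: matrix_eq vec_eq_iff real_diag_mult_vector_nth flip: matrix_vector_mul_assoc)

lemma real_diag_one [simp]: "real_diag (\<lambda>j. 1) = mat 1"
  by (simp add: real_diag_def mat_def vec_eq_iff)

lemma diagonalised_mult_vector:
  "(W ** real_diag r ** Z) *v x = W *v (real_diag r *v (Z *v x))"
  by (simp flip: matrix_vector_mul_assoc)

lemma diagonalised_nth:
  "(W ** real_diag r ** Z) $ i $ j
    = (\<Sum>k\<in>UNIV. W $ i $ k * complex_of_real (r k) * Z $ k $ j)"
proof -
  have "(W ** real_diag r) $ i $ k = W $ i $ k * complex_of_real (r k)" for k
  proof -
    have "(W ** real_diag r) $ i $ k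
        = (\<Sum>l\<in>UNIV. if l = k then W $ i $ k * complex_of_real (r k) else 0)"
      unfolding real_diag_def matrix_matrix_mult_def vec_lambda_beta by (rule sum.cong) auto
    then show ?thesis by simp
  qed
  then show ?thesis
    by (simp add: matrix_matrix_mult_def[of _ Z])
qed

lemma diagonalised_add:
  "W ** real_diag r ** Z + W ** real_diag q ** Z = W ** real_diag (\<lambda>j. r j + q j) ** Z"
  by (simp add: vec_eq_iff diagonalised_nth algebra_simps sum.distrib)

lemma diagonalised_scaleR:
  "c *\<^sub>R (W ** real_diag r ** Z) = W ** real_diag (\<lambda>j. c * r j) ** Z"
  by (simp add: vec_eq_iff diagonalised_nth scaleR_conv_of_real[where 'a=complex]
      sum_distrib_left mult_ac)

lemma matrix_inverse_unique:
  fixes A :: "'a::semiring_1^'n^'n"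
  assumes "A ** B = mat 1" "B ** A = mat 1"
  shows "matrix_inv A = B"
proof -
  have "A ** matrix_inv A = mat 1 \<and> matrix_inv A ** A = mat 1"
    unfolding matrix_inv_def by (rule someI[of _ B]) (simp add: assms)
  then have "matrix_inv A ** A ** B = B" by simp
  then show ?thesis
    using assms(1) by (simp flip: matrix_mul_assoc)
qed

lemma diagonalised_inverse:
  assumes "unitary_matrix W" "unitary_matrix V" "\<And>j. r j \<noteq> 0"
  shows "W ** real_diag r ** adjoint_matrix V ** (V ** real_diag (\<lambda>j. inverse (r j)) ** adjoint_matrix W)
    = mat 1"
proof -
  have "W ** real_diag r ** adjoint_matrix V ** (V ** real_diag (\<lambda>j. inverse (r j)) ** adjoint_matrix W)
      = W ** (real_diag r ** ((adjoint_matrix V ** V) ** real_diag (\<lambda>j. inverse (r j)))) ** adjoint_matrix W"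
    by (simp only: matrix_mul_assoc)
  then show ?thesis
    using assms by (simp add: unitary_matrix_def real_diag_mult)
qed

lemma diagonalised_invertible:
  assumes "unitary_matrix W" "unitary_matrix V" "\<And>j. r j \<noteq> 0"
  shows "invertible (W ** real_diag r ** adjoint_matrix V)"
  using diagonalised_inverse[of W V r] diagonalised_inverse[of V W "\<lambda>j. inverse (r j)"] assms
  unfolding invertible_def by auto

lemma adjoint_inverse_diagonalised:
  assumes "unitary_matrix W" "unitary_matrix V" "\<And>j. r j \<noteq> 0"
  shows "adjoint_matrix (matrix_inv (W ** real_diag r ** adjoint_matrix V))
    = W ** real_diag (\<lambda>j. inverse (r j)) ** adjoint_matrix V"
proof -
  have "matrix_inv (W ** real_diag r ** adjoint_matrix V)
      = V ** real_diag (\<lambda>j. inverse (r j)) ** adjoint_matrix W"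
    using diagonalised_inverse[of W V r] diagonalised_inverse[of V W "\<lambda>j. inverse (r j)"] assms
    by (intro matrix_inverse_unique) auto
  then show ?thesis
    by (simp add: adjoint_matrix_mult matrix_mul_assoc)
qed

text \<open>The next two lemmas together say that the spectral norm is the maximum of the \<open>\<bar>r j\<bar>\<close>; the lower
  bound comes from the \<open>j\<close>-th column of \<open>V\<close>.\<close>

lemma spectral_norm_diagonalised_le:
  fixes W V :: "complex^'n^'n"
  assumes "unitary_matrix W" "unitary_matrix V" "\<And>j. \<bar>r j\<bar> \<le> c"
  shows "spectral_norm (W ** real_diag r ** adjoint_matrix V) \<le> c"
  unfolding spectral_norm_def
proof (rule onorm_le)
  fix x :: "complex^'n"
  define y where "y = adjoint_matrix V *v x"
  have "0 \<le> c" using assms(3) abs_ge_zero order_trans by blast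
  have "norm ((W ** real_diag r ** adjoint_matrix V) *v x) = norm (real_diag r *v y)"
    using assms(1) by (simp add: diagonalised_mult_vector norm_unitary_matrix_mult y_def)
  also have "\<dots> \<le> norm (c *\<^sub>R y)"
    using assms(3) by (intro norm_le_componentwise_cart)
      (simp add: real_diag_mult_vector_nth norm_mult \<open>0 \<le> c\<close> mult_right_mono)
  also have "\<dots> = c * norm x"
    using assms(2) \<open>0 \<le> c\<close> by (simp add: y_def norm_unitary_matrix_mult unitary_matrix_adjoint)
  finally show "norm ((W ** real_diag r ** adjoint_matrix V) *v x) \<le> c * norm x" .
qed

lemma spectral_norm_diagonalised_ge:
  fixes W V :: "complex^'n^'n"
  assumes "unitary_matrix W" "unitary_matrix V"
  shows "\<bar>r j\<bar> \<le> spectral_norm (W ** real_diag r ** adjoint_matrix V)"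
proof -
  let ?A = "W ** real_diag r ** adjoint_matrix V"
  define x where "x = V *v axis j 1"
  have "adjoint_matrix V *v x = axis j 1"
    using assms(2) by (simp add: x_def matrix_vector_mul_assoc unitary_matrix_def)
  moreover have "real_diag r *v axis j 1 = r j *\<^sub>R axis j 1"
    by (auto simp: vec_eq_iff real_diag_mult_vector_nth axis_def
        scaleR_conv_of_real[where 'a=complex])
  moreover have "norm x = 1"
    using assms(2) by (simp add: x_def norm_unitary_matrix_mult)
  ultimately have "norm (?A *v x) = \<bar>r j\<bar> * norm x"
    using assms(1) by (simp add: diagonalised_mult_vector norm_unitary_matrix_mult)
  with \<open>norm x = 1\<close> show ?thesis
    unfolding spectral_norm_def
    using onorm[OF matrix_vector_mul_bounded_linear, of ?A x] by simp
qed

lemma hermitian_pos_def_diagonalised: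
  fixes V :: "complex^'n^'n"
  assumes "unitary_matrix V" "\<And>j. r j > 0"
  shows "hermitian_pos_def (V ** real_diag r ** adjoint_matrix V)"
  unfolding hermitian_pos_def_def
proof (intro conjI allI impI)
  show "adjoint_matrix (V ** real_diag r ** adjoint_matrix V) = V ** real_diag r ** adjoint_matrix V"
    by (simp add: adjoint_matrix_mult matrix_mul_assoc)
next
  fix x :: "complex^'n" assume "x \<noteq> 0"
  define y where "y = adjoint_matrix V *v x"
  have "norm y = norm x"
    using assms(1) by (simp add: y_def norm_unitary_matrix_mult unitary_matrix_adjoint)
  with \<open>x \<noteq> 0\<close> have "y \<noteq> 0" by auto
  then obtain i where i: "y $ i \<noteq> 0" by (auto simp: vec_eq_iff)
  have "(\<Sum>i\<in>UNIV. cnj (x $ i) * ((V ** real_diag r ** adjoint_matrix V) *v x) $ i)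
      = (\<Sum>i\<in>UNIV. cnj (y $ i) * (real_diag r *v y) $ i)"
    by (simp add: diagonalised_mult_vector adjoint_matrix_inner[of x V] y_def)
  also have "\<dots> = (\<Sum>i\<in>UNIV. complex_of_real (r i * (cmod (y $ i))\<^sup>2))"
    by (intro sum.cong refl) (simp add: real_diag_mult_vector_nth complex_norm_square mult_ac
        del: of_real_power)
  finally have "Re (\<Sum>i\<in>UNIV. cnj (x $ i) * ((V ** real_diag r ** adjoint_matrix V) *v x) $ i)
      = (\<Sum>i\<in>UNIV. r i * (cmod (y $ i))\<^sup>2)"
    by (simp flip: of_real_sum)
  also have "\<dots> > 0"
    using i assms(2) by (intro sum_pos2[of _ i]) (auto simp: less_imp_le)
  finally show "0 < Re (\<Sum>i\<in>UNIV. cnj (x $ i) * ((V ** real_diag r ** adjoint_matrix V) *v x) $ i)" .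
qed

lemma tendsto_diagonalised:
  fixes W Z :: "complex^'n^'n"
  assumes "\<And>j. ((\<lambda>k. r k j) \<longlongrightarrow> q j) F"
  shows "((\<lambda>k. W ** real_diag (r k) ** Z) \<longlongrightarrow> W ** real_diag q ** Z) F"
proof -
  have "((\<lambda>k. (W ** real_diag (r k) ** Z) $ i $ j) \<longlongrightarrow> (W ** real_diag q ** Z) $ i $ j) F" for i j
    unfolding diagonalised_nth by (intro tendsto_intros assms)
  then show ?thesis
    by (intro vec_tendstoI)
qed

section \<open>The scalar iteration\<close>

text \<open>Newton's iteration for the equation \<open>x\<^sup>2 = 1\<close>, to which every singular value is subject.\<close>

definition newton_scalar :: "real \<Rightarrow> real" where
  "newton_scalar x = (x + inverse x) / 2"

text \<open>For \<open>x = exp a\<close> this is \<open>sinh \<bar>a\<bar>\<close>; it measures how far \<open>x\<close> is from 1 and does not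
  distinguish \<open>x\<close> from its inverse.\<close>

definition deviation :: "real \<Rightarrow> real" where
  "deviation x = \<bar>x - inverse x\<bar> / 2"

lemma deviation_nonneg [simp]: "0 \<le> deviation x"
  by (simp add: deviation_def)

lemma newton_scalar_eq_sqrt:
  assumes "x > 0"
  shows "newton_scalar x = sqrt ((deviation x)\<^sup>2 + 1)"
proof (rule real_sqrt_unique[symmetric])
  show "(newton_scalar x)\<^sup>2 = (deviation x)\<^sup>2 + 1"
    using assms by (simp add: newton_scalar_def deviation_def field_simps power2_eq_square)
  show "0 \<le> newton_scalar x" using assms by (simp add: newton_scalar_def)
qed

lemma newton_scalar_ge_1: "x > 0 \<Longrightarrow> 1 \<le> newton_scalar x"
  by (simp add: newton_scalar_eq_sqrt)

lemma newton_scalar_funpow_pos: "x > 0 \<Longrightarrow> (newton_scalar ^^ k) x > 0"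
  by (induction k) (auto simp: newton_scalar_def add_pos_pos)

lemma deviation_newton_scalar:
  assumes "x > 0"
  shows "deviation (newton_scalar x) = omega_fun (deviation x)"
proof -
  define t where "t = deviation x"
  define r where "r = sqrt (t\<^sup>2 + 1)"
  have r: "r \<ge> 1" "r\<^sup>2 = t\<^sup>2 + 1" by (simp_all add: r_def)
  then have "inverse r \<le> 1" by (simp add: inverse_le_1_iff)
  then have "deviation r = (r - inverse r) / 2" using r(1) by (simp add: deviation_def)
  also have "\<dots> = (r\<^sup>2 - 1) / (2 * r)" using r(1) by (simp add: field_simps power2_eq_square)
  also have "\<dots> = omega_fun t" by (simp add: r(2)) (simp add: omega_fun_def r_def)
  finally show ?thesis
    using assms by (simp add: newton_scalar_eq_sqrt t_def r_def)
qed

lemma deviation_newton_scalar_funpow: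
  "x > 0 \<Longrightarrow> deviation ((newton_scalar ^^ k) x) = (omega_fun ^^ k) (deviation x)"
  by (induction k) (simp_all add: deviation_newton_scalar newton_scalar_funpow_pos)

lemma sigma_fun_deviation:
  assumes "x \<ge> 1"
  shows "\<bar>1 - x\<bar> = sigma_fun (deviation x)"
proof -
  have "inverse x \<le> 1" using assms by (simp add: inverse_le_1_iff)
  then have "deviation x = (x - inverse x) / 2" using assms by (simp add: deviation_def)
  moreover have "sqrt ((deviation x)\<^sup>2 + 1) = (x + inverse x) / 2"
    using newton_scalar_eq_sqrt[of x] assms by (simp add: newton_scalar_def)
  ultimately show ?thesis
    using assms by (simp add: sigma_fun_def diff_divide_distrib add_divide_distrib)
qed

lemma abs_one_minus_le_sigma_fun_deviation:
  assumes "x > 0"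
  shows "\<bar>1 - x\<bar> \<le> sigma_fun (deviation x)"
proof (cases "x \<ge> 1")
  case False
  then have *: "inverse x \<ge> 1" using assms by (simp add: one_le_inverse_iff)
  \<comment> \<open>The bound for \<open>1/x\<close> suffices: \<open>1 - x = x * (1/x - 1)\<close> with \<open>x < 1\<close>.\<close>
  have "\<bar>1 - x\<bar> = x * (inverse x - 1)" using False assms by (simp add: field_simps)
  also have "\<dots> \<le> inverse x - 1" using False * by (intro mult_left_le_one_le) (use assms in auto)
  also have "\<dots> = sigma_fun (deviation (inverse x))"
    using sigma_fun_deviation[OF *] * by simp
  also have "deviation (inverse x) = deviation x" by (simp add: deviation_def abs_minus_commute)
  finally show ?thesis .
qed (metis sigma_fun_deviation order_refl)

lemma omega_fun_nonneg: "0 \<le> t \<Longrightarrow> 0 \<le> omega_fun t"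
  by (simp add: omega_fun_def)

lemma omega_fun_mono:
  assumes "0 \<le> t" "t \<le> u"
  shows "omega_fun t \<le> omega_fun u"
proof -
  \<comment> \<open>\<open>omega_fun t\<close> is half of \<open>r - 1/r\<close>, increasing in \<open>r = sqrt (t\<^sup>2 + 1)\<close>.\<close>
  have eq: "omega_fun v = (sqrt (v\<^sup>2 + 1) - inverse (sqrt (v\<^sup>2 + 1))) / 2" for v
  proof -
    have "sqrt (v\<^sup>2 + 1) > 0" "(sqrt (v\<^sup>2 + 1))\<^sup>2 = v\<^sup>2 + 1"
      by (simp_all add: add_nonneg_pos)
    then show ?thesis by (simp add: omega_fun_def field_simps power2_eq_square)
  qed
  have "sqrt (t\<^sup>2 + 1) \<le> sqrt (u\<^sup>2 + 1)" using assms by (simp add: power_mono)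
  moreover from this have "inverse (sqrt (u\<^sup>2 + 1)) \<le> inverse (sqrt (t\<^sup>2 + 1))"
    by (intro le_imp_inverse_le) (simp_all add: add_nonneg_pos)
  ultimately show ?thesis unfolding eq by (intro divide_right_mono diff_mono) simp_all
qed

lemma omega_fun_funpow_nonneg: "0 \<le> t \<Longrightarrow> 0 \<le> (omega_fun ^^ k) t"
  by (induction k) (simp_all add: omega_fun_nonneg)

lemma omega_fun_funpow_mono: "0 \<le> t \<Longrightarrow> t \<le> u \<Longrightarrow> (omega_fun ^^ k) t \<le> (omega_fun ^^ k) u"
  by (induction k) (simp_all add: omega_fun_mono omega_fun_funpow_nonneg)

lemma sigma_fun_mono: "0 \<le> t \<Longrightarrow> t \<le> u \<Longrightarrow> sigma_fun t \<le> sigma_fun u"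
  unfolding sigma_fun_def by (intro add_mono diff_mono) (simp_all add: power_mono)

lemma omega_fun_le_half:
  assumes "0 \<le> t"
  shows "omega_fun t \<le> t / 2"
proof -
  have "t \<le> sqrt (t\<^sup>2 + 1)" by (rule real_le_rsqrt) simp
  then have "t * t \<le> t * sqrt (t\<^sup>2 + 1)" using assms by (rule mult_left_mono)
  then show ?thesis
    by (simp add: omega_fun_def divide_le_eq power2_eq_square add_nonneg_pos)
qed

lemma tendsto_omega_fun_funpow:
  assumes "0 \<le> t"
  shows "(\<lambda>k. (omega_fun ^^ k) t) \<longlonglongrightarrow> 0"
proof (rule tendsto_sandwich[OF _ _ tendsto_const])
  have "(omega_fun ^^ k) t \<le> t * (1/2) ^ k" for k
  proof (induction k)
    case (Suc k)
    then show ?case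
      using omega_fun_le_half[OF omega_fun_funpow_nonneg[OF assms, of k]] by simp
  qed simp
  then show "\<forall>\<^sub>F k in sequentially. (omega_fun ^^ k) t \<le> t * (1/2) ^ k" by simp
  show "(\<lambda>k. t * (1/2) ^ k) \<longlonglongrightarrow> 0"
    by (intro tendsto_mult_right_zero LIMSEQ_power_zero) simp
qed (simp add: omega_fun_funpow_nonneg assms)

lemma tendsto_newton_scalar_funpow:
  assumes "x > 0"
  shows "(\<lambda>k. (newton_scalar ^^ k) x) \<longlonglongrightarrow> 1"
proof -
  have "(\<lambda>k. sigma_fun ((omega_fun ^^ k) (deviation x))) \<longlonglongrightarrow> 0 - 1 + sqrt (0\<^sup>2 + 1)"
    unfolding sigma_fun_def by (intro tendsto_intros tendsto_omega_fun_funpow) simp_all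
  then have lim: "(\<lambda>k. sigma_fun ((omega_fun ^^ k) (deviation x))) \<longlonglongrightarrow> 0" by simp
  have "norm ((newton_scalar ^^ k) x - 1) \<le> sigma_fun ((omega_fun ^^ k) (deviation x))" for k
    using abs_one_minus_le_sigma_fun_deviation[OF newton_scalar_funpow_pos[OF assms, of k]]
    by (simp add: deviation_newton_scalar_funpow assms abs_minus_commute)
  then have "(\<lambda>k. (newton_scalar ^^ k) x - 1) \<longlonglongrightarrow> 0"
    by (intro Lim_null_comparison[OF _ lim] always_eventually allI)
  then show ?thesis by (simp add: LIM_zero_iff)
qed

section \<open>The matrix iteration\<close>

lemma newton_iterate_diagonal:
  assumes "unitary_matrix W" "unitary_matrix V" "\<And>j. s j > 0"
  shows "newton_iterate (W ** real_diag s ** adjoint_matrix V) k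
    = W ** real_diag (\<lambda>j. (newton_scalar ^^ k) (s j)) ** adjoint_matrix V"
proof (induction k)
  case (Suc k)
  have "(newton_scalar ^^ k) (s j) \<noteq> 0" for j
    using newton_scalar_funpow_pos[OF assms(3), of k j] by simp
  then show ?case
    using assms(1,2)
    by (simp add: Suc.IH adjoint_inverse_diagonalised diagonalised_add diagonalised_scaleR)
      (simp add: newton_scalar_def)
qed simp

theorem theorem3p2:
  fixes A W V :: "complex^'n^'n" and s :: "'n \<Rightarrow> real"
  assumes "unitary_matrix W" and "unitary_matrix V"
    and "\<And>j. s j > 0"
    and "A = W ** real_diag s ** adjoint_matrix V"
  defines "U \<equiv> W ** adjoint_matrix V"
    and "t0 \<equiv> (1/2) * Max (range (\<lambda>j. \<bar>s j - inverse (s j)\<bar>))"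
  shows "polar_decomposition A U (V ** real_diag s ** adjoint_matrix V)
    \<and> (\<forall>k. invertible (newton_iterate A k))
    \<and> newton_iterate A \<longlonglongrightarrow> U
    \<and> (\<forall>k. spectral_norm (U - newton_iterate A k) \<le> sigma_fun ((omega_fun ^^ k) t0))
    \<and> (\<forall>k\<ge>1. spectral_norm (U - newton_iterate A k) = sigma_fun ((omega_fun ^^ k) t0))"
proof -
  define r where "r k j = (newton_scalar ^^ k) (s j)" for k j
  have r_pos: "r k j > 0" for k j
    using assms(3) by (simp add: r_def newton_scalar_funpow_pos)
  have iterate: "newton_iterate A k = W ** real_diag (r k) ** adjoint_matrix V" for k
    using assms(1-4) by (simp add: newton_iterate_diagonal r_def[abs_def])
  have U_diag: "U = W ** real_diag (\<lambda>j. 1) ** adjoint_matrix V"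
    by (simp add: U_def)

  have "U ** (V ** real_diag s ** adjoint_matrix V)
      = W ** ((adjoint_matrix V ** V) ** real_diag s) ** adjoint_matrix V"
    by (simp only: U_def matrix_mul_assoc)
  then have polar: "polar_decomposition A U (V ** real_diag s ** adjoint_matrix V)"
    using assms(1-4) unfolding polar_decomposition_def
    by (auto simp: U_def unitary_matrix_mult unitary_matrix_adjoint hermitian_pos_def_diagonalised)
      (simp add: unitary_matrix_def)

  have invertible: "invertible (newton_iterate A k)" for k
    unfolding iterate using assms(1,2) r_pos[of k]
    by (intro diagonalised_invertible) (auto simp: less_imp_neq[symmetric])

  have "(\<lambda>k. r k j) \<longlonglongrightarrow> 1" for j
    unfolding r_def using assms(3) by (rule tendsto_newton_scalar_funpow)
  then have limit: "newton_iterate A \<longlonglongrightarrow> U"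
    unfolding U_diag iterate[abs_def] by (rule tendsto_diagonalised)

  have error: "U - newton_iterate A k = W ** real_diag (\<lambda>j. 1 - r k j) ** adjoint_matrix V" for k
  proof -
    have "W ** real_diag (\<lambda>j. 1 - r k j) ** adjoint_matrix V + newton_iterate A k = U"
      by (simp add: iterate diagonalised_add U_def)
    then show ?thesis by (simp add: algebra_simps)
  qed

  have dev_le: "deviation (s j) \<le> t0" for j
    unfolding t0_def deviation_def by simp
  have "Max (range (\<lambda>j. \<bar>s j - inverse (s j)\<bar>)) \<in> range (\<lambda>j. \<bar>s j - inverse (s j)\<bar>)"
    by (rule Max_in) auto
  then obtain m where m: "t0 = deviation (s m)"
    by (auto simp: t0_def deviation_def image_iff)

  have dev_r: "deviation (r k j) = (omega_fun ^^ k) (deviation (s j))" for k j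
    using assms(3) by (simp add: r_def deviation_newton_scalar_funpow)
  have bound: "spectral_norm (U - newton_iterate A k) \<le> sigma_fun ((omega_fun ^^ k) t0)" for k
    unfolding error using assms(1,2)
  proof (rule spectral_norm_diagonalised_le)
    fix j
    have "\<bar>1 - r k j\<bar> \<le> sigma_fun ((omega_fun ^^ k) (deviation (s j)))"
      using abs_one_minus_le_sigma_fun_deviation[OF r_pos] by (simp add: dev_r)
    also have "\<dots> \<le> sigma_fun ((omega_fun ^^ k) t0)"
      by (intro sigma_fun_mono omega_fun_funpow_mono omega_fun_funpow_nonneg dev_le) simp_all
    finally show "\<bar>1 - r k j\<bar> \<le> sigma_fun ((omega_fun ^^ k) t0)" .
  qed

  have "spectral_norm (U - newton_iterate A k) = sigma_fun ((omega_fun ^^ k) t0)" if "k \<ge> 1" for k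
  proof (rule antisym[OF bound])
    from that obtain l where "k = Suc l" by (cases k) auto
    then have "r k m \<ge> 1"
      using newton_scalar_ge_1[OF r_pos[of l m]] by (simp add: r_def)
    then have "sigma_fun ((omega_fun ^^ k) t0) = \<bar>1 - r k m\<bar>"
      by (simp only: sigma_fun_deviation dev_r m)
    also have "\<dots> \<le> spectral_norm (U - newton_iterate A k)"
      unfolding error by (rule spectral_norm_diagonalised_ge[OF assms(1,2)])
    finally show "sigma_fun ((omega_fun ^^ k) t0) \<le> spectral_norm (U - newton_iterate A k)" .
  qed
  with polar invertible limit bound show ?thesis by blast
qed

end
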